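(* Let $\mathbb{K}$ be a field of characteristic two, $W=x+y+x^{-1}y^{-1}\in A=\mathbb{K}[x^{\pm1},y^{\pm1}]$, and let $$Q_{\mathbb{R}P^2}=\begin{pmatrix}0&1&1&x^{-1}y^{-1}\\ y&0&x^{-1}&1\\ x&y^{-1}&0&1\\ 1&x&y&0\end{pmatrix},$$ an ungraded matrix factorization of $W$ (on $A^4$). Then the map $$\mathcal{C}:\mathrm{Jac}(W)\to \mathrm{Hom}_{H(\mathcal{MF}^{un}(W))}(Q_{\mathbb{R}P^2},Q_{\mathbb{R}P^2}),\qquad \alpha\mapsto\alpha\cdot\mathrm{Id},$$ is an isomorphism.
   Context: An ungraded matrix factorization of $W\in A$ is a pair $(E,Q)$ with $E$ a finite dimensional free $A$-module and $Q:E\to E$ an $A$-module homomorphism with $Q^2=W\cdot\mathrm{Id}_E$. $\mathcal{MF}^{un}(W)$ is the category whose objects are ungraded matrix factorizations of $W$; the morphism space $\mathrm{Hom}((E,Q),(F,R))$ is the space of all $A$-module homomorphisms $f:E\to F$, with differential $d_{Q,R}(f)=R\circ f+f\circ Q$ (which squares to zero). The homotopy category $H(\mathcal{MF}^{un}(W))$ has the same objects and $\mathrm{Hom}_{H(\mathcal{MF}^{un}(W))}(X,Y)=\ker(d_{X,Y})/\mathrm{im}(d_{X,Y})$. The Jacobian ring is $\mathrm{Jac}(W)=A/\langle\partial_xW,\partial_yW\rangle$. *)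

theory Defs
  imports
    "HOL-Analysis.Analysis"
    "HOL-Algebra.Algebra"
    "HOL-Algebra.Algebraic_Closure_Type"
    "HOL-Library.Poly_Mapping"
begin

text \<open>
  The ring \<open>K[x\<^sup>\<plusminus>\<^sup>1, y\<^sup>\<plusminus>\<^sup>1]\<close> is the group ring of \<open>\<int> \<times> \<int>\<close>: finitely supported functions with
  the convolution product, the pair \<open>(i, j)\<close> standing for the monomial \<open>x\<^sup>i y\<^sup>j\<close>.
\<close>

type_synonym 'k laurent2 = "(int \<times> int) \<Rightarrow>\<^sub>0 'k"

definition mono_xy :: "int \<Rightarrow> int \<Rightarrow> 'k::comm_ring_1 laurent2"
  where "mono_xy i j = Poly_Mapping.single (i, j) 1"

definition partial_x :: "'k::comm_ring_1 laurent2 \<Rightarrow> 'k laurent2"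
  where "partial_x p =
    (\<Sum>(i, j) \<in> Poly_Mapping.keys p.
      Poly_Mapping.single (i - 1, j) (of_int i * Poly_Mapping.lookup p (i, j)))"

definition partial_y :: "'k::comm_ring_1 laurent2 \<Rightarrow> 'k laurent2"
  where "partial_y p =
    (\<Sum>(i, j) \<in> Poly_Mapping.keys p.
      Poly_Mapping.single (i, j - 1) (of_int j * Poly_Mapping.lookup p (i, j)))"

definition jac_ideal :: "'k::comm_ring_1 laurent2 \<Rightarrow> 'k laurent2 set"
  where "jac_ideal W = genideal ring_of_type_algebra {partial_x W, partial_y W}"

definition Jac :: "'k::comm_ring_1 laurent2 \<Rightarrow> 'k laurent2 set ring"
  where "Jac W = ring_of_type_algebra Quot jac_ideal W"

definition jac_class :: "'k::comm_ring_1 laurent2 \<Rightarrow> 'k laurent2 \<Rightarrow> 'k laurent2 set"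
  where "jac_class W \<alpha> = jac_ideal W +>\<^bsub>ring_of_type_algebra\<^esub> \<alpha>"


text \<open>
  Modules and module homomorphisms are those of \<^theory>\<open>HOL.Modules\<close> (not of
  \<^theory>\<open>HOL-Algebra.Module\<close>): a module is a scalar multiplication on an abelian group type.
\<close>

definition fin_free_module :: "('a::comm_ring_1 \<Rightarrow> 'e::ab_group_add \<Rightarrow> 'e) \<Rightarrow> bool"
  where "fin_free_module s \<longleftrightarrow> Modules.module s \<and>
    (\<exists>B. finite B \<and> \<not> module.dependent s B \<and> module.span s B = UNIV)"

text \<open>A pair \<open>(s, Q)\<close> consists of the scalar multiplication \<open>s\<close> of the module and its endomorphism \<open>Q\<close>.\<close>

type_synonym ('a, 'e) mf_pair = "('a \<Rightarrow> 'e \<Rightarrow> 'e) \<times> ('e \<Rightarrow> 'e)"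

definition ungraded_mf :: "'a::comm_ring_1 \<Rightarrow> ('a, 'e::ab_group_add) mf_pair \<Rightarrow> bool"
  where "ungraded_mf W E \<longleftrightarrow> (case E of (s, Q) \<Rightarrow>
    fin_free_module s \<and> Modules.module_hom s s Q \<and> (\<forall>v. Q (Q v) = s W v))"

definition mf_hom ::
    "('a::comm_ring_1, 'e::ab_group_add) mf_pair \<Rightarrow> ('a, 'f::ab_group_add) mf_pair \<Rightarrow> ('e \<Rightarrow> 'f) set"
  where "mf_hom E F = {f. Modules.module_hom (fst E) (fst F) f}"

definition mf_diff ::
    "('a, 'e) mf_pair \<Rightarrow> ('a, 'f::ab_group_add) mf_pair \<Rightarrow> ('e \<Rightarrow> 'f) \<Rightarrow> 'e \<Rightarrow> 'f"
  where "mf_diff E F f = (\<lambda>v. snd F (f v) + f (snd E v))"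

definition mf_ker ::
    "('a::comm_ring_1, 'e::ab_group_add) mf_pair \<Rightarrow> ('a, 'f::ab_group_add) mf_pair \<Rightarrow> ('e \<Rightarrow> 'f) set"
  where "mf_ker E F = {f \<in> mf_hom E F. mf_diff E F f = (\<lambda>v. 0)}"

definition mf_im ::
    "('a::comm_ring_1, 'e::ab_group_add) mf_pair \<Rightarrow> ('a, 'f::ab_group_add) mf_pair \<Rightarrow> ('e \<Rightarrow> 'f) set"
  where "mf_im E F = mf_diff E F ` mf_hom E F"

definition mf_ker_ring ::
    "('a::comm_ring_1, 'e::ab_group_add) mf_pair \<Rightarrow> ('e \<Rightarrow> 'e) ring"
  where "mf_ker_ring E =
    \<lparr>carrier = mf_ker E E, monoid.mult = (\<lambda>f g. f \<circ> g), one = id,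
     ring.zero = (\<lambda>v. 0), add = (\<lambda>f g v. f v + g v)\<rparr>"

text \<open>
  The endomorphism space \<open>ker d / im d\<close> of \<open>E\<close> in the homotopy category, with composition as
  multiplication.  In characteristic two \<open>d\<close> squares to zero and satisfies the Leibniz rule
  \<open>d (f \<circ> g) = d f \<circ> g + f \<circ> d g\<close>, so that \<open>ker d\<close> is a ring and \<open>im d\<close> restricted to it an ideal.
\<close>

definition mf_end_H ::
    "('a::comm_ring_1, 'e::ab_group_add) mf_pair \<Rightarrow> ('e \<Rightarrow> 'e) set ring"
  where "mf_end_H E = mf_ker_ring E Quot mf_im E E"

definition mf_class ::
    "('a::comm_ring_1, 'e::ab_group_add) mf_pair \<Rightarrow> ('e \<Rightarrow> 'e) \<Rightarrow> ('e \<Rightarrow> 'e) set"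
  where "mf_class E f = mf_im E E +>\<^bsub>mf_ker_ring E\<^esub> f"


definition W_pot :: "'k::comm_ring_1 laurent2"
  where "W_pot = mono_xy 1 0 + mono_xy 0 1 + mono_xy (-1) (-1)"

definition Q_RP2_matrix :: "'k::comm_ring_1 laurent2 ^ 4 ^ 4"
  where "Q_RP2_matrix = vector [
    vector [0,           1,              1,              mono_xy (-1) (-1)],
    vector [mono_xy 0 1, 0,              mono_xy (-1) 0, 1],
    vector [mono_xy 1 0, mono_xy 0 (-1), 0,              1],
    vector [1,           mono_xy 1 0,    mono_xy 0 1,    0]]"

definition Q_RP2 :: "('k::comm_ring_1 laurent2, 'k laurent2 ^ 4) mf_pair"
  where "Q_RP2 = ((*s), (*v) Q_RP2_matrix)"

end

theory Submission
  imports Defs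
begin

text \<open>
  Let \<open>B = K[u\<^sup>\<plusminus>\<^sup>1, v\<^sup>\<plusminus>\<^sup>1]\<close> be the double cover of \<open>A\<close> with \<open>u\<^sup>2 = x\<close> and \<open>v\<^sup>2 = y\<close>. It is free of rank
  four over \<open>A\<close>, and in the basis \<open>1, v\<^sup>-\<^sup>1, u\<^sup>-\<^sup>1, u\<^sup>-\<^sup>1v\<^sup>-\<^sup>1\<close> the matrix of multiplication by
  \<open>w = u + v + u\<^sup>-\<^sup>1v\<^sup>-\<^sup>1\<close> is the given one (\<open>to_cover_Q\<close>). Squaring is additive in
  characteristic two, so \<open>w\<^sup>2 = W\<close>; this is why the matrix is a factorization of \<open>W\<close>.
  The differential on endomorphisms thus becomes \<open>g \<mapsto> [w, g]\<close> on the \<open>A\<close>-linear maps \<open>B \<rightarrow> B\<close>.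

  In characteristic two \<open>\<partial>\<^sub>u\<close> and \<open>\<partial>\<^sub>v\<close> are \<open>A\<close>-linear, because they kill squares, and every
  \<open>A\<close>-linear endomorphism of \<open>B\<close> is a differential operator
  \<open>a + b \<partial>\<^sub>u + c \<partial>\<^sub>v + e \<partial>\<^sub>u\<partial>\<^sub>v\<close> with coefficients in \<open>B\<close> (\<open>dbl_linear_imp_diff_op\<close>). By the
  Leibniz rule its commutator with \<open>w\<close> is
  \<open>(b w\<^sub>u + c w\<^sub>v + e w\<^sub>u\<^sub>v) + e w\<^sub>v \<partial>\<^sub>u + e w\<^sub>u \<partial>\<^sub>v\<close>, a Koszul complex of \<open>(w\<^sub>u, w\<^sub>v)\<close> up to the term
  \<open>e w\<^sub>u\<^sub>v\<close>. This pair is a regular sequence (\<open>koszul_exact\<close>), so every cocycle is a multiplication by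
  an element of \<open>B\<close> plus a coboundary, and multiplication by \<open>b\<close> is a coboundary exactly if \<open>b\<close>
  lies in \<open>I = (w\<^sub>u, w\<^sub>v)\<close>. Hence the endomorphism ring in the homotopy category is \<open>B / I\<close>.

  It remains to see that \<open>A \<rightarrow> B\<close> induces an isomorphism \<open>Jac W \<rightarrow> B / I\<close>. Name the variables of \<open>B\<close>
  again \<open>x, y\<close>. Then \<open>B = A\<close> as rings, \<open>w\<close> is \<open>W\<close> and \<open>I\<close> is the Jacobian ideal, while the inclusion
  \<open>A \<rightarrow> B\<close> turns into the \<open>K\<close>-linear map \<open>dbl\<close> that doubles exponents. Modulo \<open>I\<close> one has
  \<open>x\<^sup>2y = xy\<^sup>2 = 1\<close>, so \<open>x\<^sup>3 = y\<^sup>3 = 1\<close> and \<open>dbl \<circ> dbl\<close>, which replaces \<open>x, y\<close> by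
  \<open>x\<^sup>4, y\<^sup>4\<close>, is the identity modulo \<open>I\<close> (\<open>diff_dbl_dbl\<close>). So \<open>dbl\<close> is bijective modulo \<open>I\<close>.
\<close>

section \<open>Finitely supported functions and Laurent polynomials\<close>

lemma poly_mapping_induct_add [case_names single add]:
  fixes p :: "'a \<Rightarrow>\<^sub>0 'c::comm_monoid_add"
  assumes single: "\<And>k c. P (Poly_Mapping.single k c)"
    and add: "\<And>p q. P p \<Longrightarrow> P q \<Longrightarrow> P (p + q)"
  shows "P p"
proof (induction p rule: Poly_Mapping.update_induct)
  case const
  show ?case using single[of undefined 0] by simp
next
  case (update f a b)
  have "Poly_Mapping.update a b f = f + Poly_Mapping.single a b"
    using update.hyps(1)
    by (intro poly_mapping_eqI) (auto simp: lookup_update lookup_add lookup_single in_keys_iff when_def)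
  then show ?case using update.IH single add by metis
qed

text \<open>
  Extending an additive family \<open>F\<close> from monomials to all finitely supported functions is
  additive. This covers both the push-forward along a map of exponents and the partial derivatives.
\<close>
lemma sum_keys_add:
  fixes p q :: "'a \<Rightarrow>\<^sub>0 'c::comm_monoid_add" and F :: "'a \<Rightarrow> 'c \<Rightarrow> 'd::comm_monoid_add"
  assumes F0: "\<And>k. F k 0 = 0" and Fadd: "\<And>k a b. F k (a + b) = F k a + F k b"
  shows "(\<Sum>k\<in>Poly_Mapping.keys (p + q). F k (Poly_Mapping.lookup (p + q) k)) =
    (\<Sum>k\<in>Poly_Mapping.keys p. F k (Poly_Mapping.lookup p k)) +
    (\<Sum>k\<in>Poly_Mapping.keys q. F k (Poly_Mapping.lookup q k))"
proof -
  let ?S = "Poly_Mapping.keys p \<union> Poly_Mapping.keys q"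
  have *: "(\<Sum>k\<in>Poly_Mapping.keys r. F k (Poly_Mapping.lookup r k)) =
      (\<Sum>k\<in>?S. F k (Poly_Mapping.lookup r k))" if "Poly_Mapping.keys r \<subseteq> ?S" for r
    using that by (intro sum.mono_neutral_left) (auto simp: F0 in_keys_iff)
  show ?thesis
    by (subst (1 2 3) *) (use Poly_Mapping.keys_add[of p q] in \<open>auto simp: lookup_add Fadd sum.distrib\<close>)
qed

lemma sum_keys_single:
  assumes "F k 0 = 0"
  shows "(\<Sum>l\<in>Poly_Mapping.keys (Poly_Mapping.single k c). F l (Poly_Mapping.lookup (Poly_Mapping.single k c) l)) = F k c"
  using assms by auto

definition push :: "('a \<Rightarrow> 'b) \<Rightarrow> ('a \<Rightarrow>\<^sub>0 'c::comm_monoid_add) \<Rightarrow> 'b \<Rightarrow>\<^sub>0 'c"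
  where "push h p = (\<Sum>k\<in>Poly_Mapping.keys p. Poly_Mapping.single (h k) (Poly_Mapping.lookup p k))"

lemma push_single [simp]: "push h (Poly_Mapping.single k c) = Poly_Mapping.single (h k) c"
  unfolding push_def by (rule sum_keys_single) simp

lemma push_add: "push h (p + q) = push h p + push h q"
  unfolding push_def by (rule sum_keys_add) (simp_all add: single_add)

lemma push_0 [simp]: "push h 0 = 0"
  by (simp add: push_def)

lemma push_mult:
  fixes p q :: "'a::monoid_add \<Rightarrow>\<^sub>0 'c::semiring_0"
  assumes h: "\<And>k l. h (k + l) = h k + h l"
  shows "push h (p * q) = push h p * push h q"
proof (induction p rule: poly_mapping_induct_add)
  case (single k c)
  show ?case
    by (induction q rule: poly_mapping_induct_add) (simp_all add: mult_single h push_add distrib_left)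
qed (simp add: push_add distrib_right)

lemma push_push: "push g (push h p) = push (g \<circ> h) p"
  by (induction p rule: poly_mapping_induct_add) (simp_all add: push_add)

lemma mono_xy_mult: "mono_xy i j * mono_xy k l = mono_xy (i + k) (j + l)"
  by (simp add: mono_xy_def mult_single)

lemma mono_xy_0_0 [simp]: "mono_xy 0 0 = 1"
  by (simp add: mono_xy_def flip: single_one zero_prod_def)

lemma push_mono_xy [simp]: "push h (mono_xy i j) = mono_xy (fst (h (i, j))) (snd (h (i, j)))"
  by (simp add: mono_xy_def)

lemma lookup_single_mult:
  "Poly_Mapping.lookup (Poly_Mapping.single l c * p) (k :: 'g::ab_group_add) = c * Poly_Mapping.lookup p (k - l)"
proof (induction p rule: poly_mapping_induct_add)
  case (single m d)
  have "l + m = k \<longleftrightarrow> m = k - l" by (auto simp: algebra_simps)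
  then show ?case by (simp add: mult_single lookup_single mult_when)
qed (simp add: distrib_left lookup_add)

text \<open>
  The support of a polynomial fixed by a nontrivial monomial would be invariant under a
  nonzero translation of \<open>\<int>\<^sup>2\<close>, hence infinite.
\<close>
lemma mono_xy_mult_fixed_imp_zero:
  assumes fixed: "mono_xy i j * p = p" and ij: "(i, j) \<noteq> (0, 0)"
  shows "p = 0"
proof (rule ccontr)
  assume "p \<noteq> 0"
  then obtain a b where ab: "(a, b) \<in> Poly_Mapping.keys p"
    by (metis keys_eq_empty ex_in_conv surj_pair)
  have "(a - int n * i, b - int n * j) \<in> Poly_Mapping.keys p" for n
  proof (induction n)
    case (Suc n)
    have "Poly_Mapping.lookup p (a - int n * i, b - int n * j) =
        Poly_Mapping.lookup p (a - int (Suc n) * i, b - int (Suc n) * j)"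
      by (subst fixed [symmetric], unfold mono_xy_def, subst lookup_single_mult) (simp add: algebra_simps)
    then show ?case using Suc by (simp add: in_keys_iff)
  qed (use ab in simp)
  then have "range (\<lambda>n. (a - int n * i, b - int n * j)) \<subseteq> Poly_Mapping.keys p" by blast
  moreover have "inj (\<lambda>n. (a - int n * i, b - int n * j))"
    using ij by (auto simp: inj_def)
  ultimately show False
    using finite_subset[OF _ finite_keys] finite_imageD infinite_UNIV_nat by blast
qed

lemma partial_x_single [simp]:
  "partial_x (Poly_Mapping.single k c) = Poly_Mapping.single (fst k - 1, snd k) (of_int (fst k) * c)"
  unfolding partial_x_def case_prod_unfold prod.collapse by (rule sum_keys_single) simp

lemma partial_y_single [simp]:
  "partial_y (Poly_Mapping.single k c) = Poly_Mapping.single (fst k, snd k - 1) (of_int (snd k) * c)"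
  unfolding partial_y_def case_prod_unfold prod.collapse by (rule sum_keys_single) simp

lemma partial_x_add: "partial_x (p + q) = partial_x p + partial_x q"
  unfolding partial_x_def case_prod_unfold prod.collapse
  by (rule sum_keys_add) (simp_all add: single_add distrib_left)

lemma partial_y_add: "partial_y (p + q) = partial_y p + partial_y q"
  unfolding partial_y_def case_prod_unfold prod.collapse
  by (rule sum_keys_add) (simp_all add: single_add distrib_left)

lemma partial_x_mult: "partial_x (p * q) = partial_x p * q + p * partial_x q"
proof (induction p rule: poly_mapping_induct_add)
  case (single k c)
  show ?case
  proof (induction q rule: poly_mapping_induct_add)
    case (single l d)
    have "k + (fst l - 1, snd l) = (fst (k + l) - 1, snd (k + l))"
      "(fst k - 1, snd k) + l = (fst (k + l) - 1, snd (k + l))"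
      by (simp_all add: prod_eq_iff)
    then show ?case by (simp add: mult_single algebra_simps flip: single_add)
  qed (simp add: partial_x_add algebra_simps)
qed (simp add: partial_x_add algebra_simps)

lemma partial_y_mult: "partial_y (p * q) = partial_y p * q + p * partial_y q"
proof (induction p rule: poly_mapping_induct_add)
  case (single k c)
  show ?case
  proof (induction q rule: poly_mapping_induct_add)
    case (single l d)
    have "k + (fst l, snd l - 1) = (fst (k + l), snd (k + l) - 1)"
      "(fst k, snd k - 1) + l = (fst (k + l), snd (k + l) - 1)"
      by (simp_all add: prod_eq_iff)
    then show ?case by (simp add: mult_single algebra_simps flip: single_add)
  qed (simp add: partial_y_add algebra_simps)
qed (simp add: partial_y_add algebra_simps)

section \<open>Ideals with two generators and their trivial monomials\<close>

text \<open>
  The ideal generated by two elements, in the explicit form that the construction of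
  coboundaries uses; \<open>genideal_pair\<close> identifies it with the generated ideal.
\<close>
definition ideal2 :: "'a \<Rightarrow> 'a \<Rightarrow> 'a::comm_ring_1 set"
  where "ideal2 a b = {r * a + s * b | r s. True}"

lemma ideal2_mult: "p \<in> ideal2 a b \<Longrightarrow> q * p \<in> ideal2 a b"
proof -
  assume "p \<in> ideal2 a b"
  then obtain r s where "p = r * a + s * b"
    unfolding ideal2_def by blast
  then have "q * p = (q * r) * a + (q * s) * b" by (simp add: algebra_simps)
  then show ?thesis unfolding ideal2_def by blast
qed

lemma ideal2_add: "p \<in> ideal2 a b \<Longrightarrow> q \<in> ideal2 a b \<Longrightarrow> p + q \<in> ideal2 a b"
proof -
  assume "p \<in> ideal2 a b" "q \<in> ideal2 a b"
  then obtain r s r' s' where "p = r * a + s * b" "q = r' * a + s' * b"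
    unfolding ideal2_def by blast
  then have "p + q = (r + r') * a + (s + s') * b" by (simp add: algebra_simps)
  then show ?thesis unfolding ideal2_def by blast
qed

lemma ideal2_minus: "p \<in> ideal2 a b \<Longrightarrow> - p \<in> ideal2 a b"
  using ideal2_mult[of p a b "-1"] by simp

lemma zero_in_ideal2: "0 \<in> ideal2 a b"
  unfolding ideal2_def by (auto intro!: exI[of _ 0])

lemma generators_in_ideal2: "a \<in> ideal2 a b" "b \<in> ideal2 a b"
proof -
  have "a = 1 * a + 0 * b" "b = 0 * a + 1 * b" by simp_all
  then show "a \<in> ideal2 a b" "b \<in> ideal2 a b" unfolding ideal2_def by blast+
qed

lemma genideal_pair: "genideal ring_of_type_algebra {a, b} = ideal2 a (b :: 'a::comm_ring_1)"
proof -
  let ?R = "ring_of_type_algebra :: 'a ring"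
  interpret cring ?R by (rule cring_from_type_algebra)
  have simps: "carrier ?R = UNIV" "x \<otimes>\<^bsub>?R\<^esub> y = x * y" "x \<oplus>\<^bsub>?R\<^esub> y = x + y" "\<zero>\<^bsub>?R\<^esub> = 0" for x y
    by (simp_all add: ring_of_type_algebra_def)
  have minus: "\<ominus>\<^bsub>?R\<^esub> x = - x" for x
    by (rule sum_zero_eq_neg[symmetric]) (simp_all add: simps)
  have "ideal (ideal2 a b) ?R"
  proof (rule idealI)
    show "subgroup (ideal2 a b) (add_monoid ?R)"
    proof (rule group.subgroupI[OF a_group])
      show "ideal2 a b \<noteq> {}" using zero_in_ideal2 by blast
      show "inv\<^bsub>add_monoid ?R\<^esub> p \<in> ideal2 a b" if "p \<in> ideal2 a b" for p
        using that ideal2_minus minus unfolding a_inv_def by metis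
    qed (simp_all add: simps ideal2_add)
    show "p \<otimes>\<^bsub>?R\<^esub> q \<in> ideal2 a b" if "p \<in> ideal2 a b" for p q
      using ideal2_mult[OF that, of q] by (simp add: simps mult.commute)
  qed (simp_all add: ring_axioms simps ideal2_mult)
  moreover have "{a, b} \<subseteq> ideal2 a b"
    by (simp add: generators_in_ideal2)
  ultimately have "genideal ?R {a, b} \<subseteq> ideal2 a b"
    by (rule genideal_minimal)
  moreover have "ideal2 a b \<subseteq> genideal ?R {a, b}"
  proof
    interpret I: ideal "genideal ?R {a, b}" ?R
      by (rule genideal_ideal) (simp add: simps)
    have "a \<in> genideal ?R {a, b}" "b \<in> genideal ?R {a, b}"
      using genideal_self[of "{a, b}"] by (simp_all add: simps)
    then have "r * a + s * b \<in> genideal ?R {a, b}" for r s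
      using I.I_l_closed I.a_closed by (metis UNIV_I simps(1-3))
    then show "p \<in> ideal2 a b \<Longrightarrow> p \<in> genideal ?R {a, b}" for p
      by (auto simp: ideal2_def)
  qed
  ultimately show ?thesis by blast
qed

text \<open>
  For an ideal \<open>I\<close> these exponents form a subgroup of \<open>\<int>\<^sup>2\<close>. It reduces congruences modulo \<open>I\<close> between polynomials to linear algebra on exponents.
\<close>
definition trivial_monomials :: "'k::comm_ring_1 laurent2 set \<Rightarrow> (int \<times> int) set"
  where "trivial_monomials I = {(i, j). mono_xy i j - 1 \<in> I}"

context
  fixes a b :: "'k::comm_ring_1 laurent2"
begin

lemma trivial_monomials_add:
  assumes "k \<in> trivial_monomials (ideal2 a b)" "l \<in> trivial_monomials (ideal2 a b)"
  shows "k + l \<in> trivial_monomials (ideal2 a b)"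
proof -
  obtain i j i' j' where kl: "k = (i, j)" "l = (i', j')" by fastforce
  have "mono_xy (i + i') (j + j') - 1 = mono_xy i j * (mono_xy i' j' - 1) + (mono_xy i j - 1 :: 'k laurent2)"
    by (simp add: algebra_simps mono_xy_mult)
  moreover have "mono_xy i j - 1 \<in> ideal2 a b" "mono_xy i' j' - 1 \<in> ideal2 a b"
    using assms by (simp_all add: trivial_monomials_def kl)
  ultimately have "mono_xy (i + i') (j + j') - 1 \<in> ideal2 a b"
    by (simp only: ideal2_add ideal2_mult)
  then show ?thesis by (simp add: trivial_monomials_def kl)
qed

lemma trivial_monomials_uminus:
  assumes "k \<in> trivial_monomials (ideal2 a b)" shows "- k \<in> trivial_monomials (ideal2 a b)"
proof -
  obtain i j where kl: "k = (i, j)" by fastforce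
  have "mono_xy (- i) (- j) - 1 = - mono_xy (-i) (-j) * (mono_xy i j - 1 :: 'k laurent2)"
    by (simp add: algebra_simps mono_xy_mult)
  moreover have "mono_xy i j - 1 \<in> ideal2 a b"
    using assms by (simp add: trivial_monomials_def kl)
  ultimately have "mono_xy (- i) (- j) - 1 \<in> ideal2 a b"
    by (simp only: ideal2_mult)
  then show ?thesis by (simp add: trivial_monomials_def kl)
qed

lemma trivial_monomials_scale:
  assumes "(i, j) \<in> trivial_monomials (ideal2 a b)" shows "(n * i, n * j) \<in> trivial_monomials (ideal2 a b)"
proof -
  have *: "(int m * i, int m * j) \<in> trivial_monomials (ideal2 a b)" for m
  proof (induction m)
    case 0 show ?case by (simp add: trivial_monomials_def zero_in_ideal2)
  next
    case (Suc m)
    then show ?case using trivial_monomials_add[OF Suc assms] by (simp add: algebra_simps)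
  qed
  show ?thesis
    using *[of "nat n"] trivial_monomials_uminus[OF *[of "nat (- n)"]] by (cases "n \<ge> 0") auto
qed

text \<open>
  Monomials whose exponents differ by an element of that subgroup are congruent, so moving
  every exponent within its coset does not change the class of a polynomial.
\<close>
lemma diff_push_in_ideal2:
  assumes "\<And>k. k - h k \<in> trivial_monomials (ideal2 a b)"
  shows "p - push h p \<in> ideal2 a b"
proof (induction p rule: poly_mapping_induct_add)
  case (single k c)
  obtain i j where ij: "k - h k = (i, j)" by fastforce
  have "Poly_Mapping.single k c - Poly_Mapping.single (h k) c =
      Poly_Mapping.single (h k) c * (mono_xy i j - 1)"
    by (simp add: algebra_simps mono_xy_def mult_single flip: ij)
  moreover have "mono_xy i j - 1 \<in> ideal2 a b"
    using assms[of k] ij by (simp add: trivial_monomials_def)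
  ultimately show ?case by (simp add: ideal2_mult)
next
  case (add p q)
  have "p + q - push h (p + q) = (p - push h p) + (q - push h q)" by (simp add: push_add)
  then show ?case using ideal2_add[OF add] by metis
qed

end

section \<open>Differential operators on the double cover\<close>

text \<open>
  The inclusion of \<open>A\<close> into its double cover, with both rings written as Laurent polynomials in
  the same variables. It is linear over the coefficients, unlike the Frobenius
  map in general.
\<close>
definition dbl :: "'k::comm_ring_1 laurent2 \<Rightarrow> 'k laurent2"
  where "dbl = push (\<lambda>k. k + k)"

lemma dbl_add: "dbl (p + q) = dbl p + dbl q"
  by (simp add: dbl_def push_add)

lemma dbl_mult: "dbl (p * q) = dbl p * dbl q"
  unfolding dbl_def by (rule push_mult) (simp add: algebra_simps)

lemma dbl_single [simp]: "dbl (Poly_Mapping.single k c) = Poly_Mapping.single (k + k) c"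
  by (simp add: dbl_def)

lemma dbl_mono_xy [simp]: "dbl (mono_xy i j) = mono_xy (2 * i) (2 * j)"
  by (simp add: dbl_def)

lemma dbl_0 [simp]: "dbl 0 = 0" by (simp add: dbl_def)

lemma dbl_1 [simp]: "dbl 1 = 1"
  using dbl_mono_xy[of 0 0] by simp

text \<open>
  The \<open>A\<close>-linear endomorphisms of the double cover.
\<close>
definition dbl_linear :: "('k::comm_ring_1 laurent2 \<Rightarrow> 'k laurent2) \<Rightarrow> bool"
  where "dbl_linear g \<longleftrightarrow>
    (\<forall>p q. g (p + q) = g p + g q) \<and> (\<forall>a p. g (dbl a * p) = dbl a * g p)"

definition diff_op :: "'k::comm_ring_1 laurent2 \<Rightarrow> 'k laurent2 \<Rightarrow> 'k laurent2 \<Rightarrow> 'k laurent2 \<Rightarrow>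
    'k laurent2 \<Rightarrow> 'k laurent2"
  where "diff_op a b c e p =
    a * p + b * partial_x p + c * partial_y p + e * partial_x (partial_y p)"

text \<open>
  The monomials with exponents \<open>0\<close> and \<open>1\<close> generate the double cover over \<open>A\<close>.
\<close>
lemma dbl_linear_eqI:
  assumes g: "dbl_linear g" and h: "dbl_linear h"
    and eq: "\<And>i j. i \<in> {0, 1} \<Longrightarrow> j \<in> {0, 1} \<Longrightarrow> g (mono_xy i j) = h (mono_xy i j)"
  shows "g p = h p"
proof (induction p rule: poly_mapping_induct_add)
  case (single k c)
  obtain i j where k: "k = (i, j)" by fastforce
  have "Poly_Mapping.single k c =
      dbl (Poly_Mapping.single (i div 2, j div 2) c) * mono_xy (i mod 2) (j mod 2)"
    by (simp add: mono_xy_def mult_single k)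
  moreover have "g (mono_xy (i mod 2) (j mod 2)) = h (mono_xy (i mod 2) (j mod 2))"
    by (rule eq) (auto simp: mod2_eq_if)
  ultimately show ?case using g h unfolding dbl_linear_def by metis
qed (use g h in \<open>simp add: dbl_linear_def\<close>)

context
  assumes char2: "CHAR('k::field) = 2"
begin

lemma two_eq_0 [simp]: "(2 :: 'k) = 0"
  using of_nat_CHAR[where 'a = 'k] by (simp add: char2)

lemma laurent_two_eq_0 [simp]: "(2 :: 'k laurent2) = 0"
  by (simp flip: single_numeral)

lemma laurent_double_eq_0 [simp]: "(p :: 'k laurent2) + p = 0"
  by (simp flip: mult_2)

lemma laurent_double_eq_0_left [simp]: "(p :: 'k laurent2) + (p + q) = q"
  by (simp flip: add.assoc)

lemma laurent_uminus: "- p = (p :: 'k laurent2)"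
  using laurent_double_eq_0[of p] by (simp only: neg_eq_iff_add_eq_0)

lemma laurent_diff: "p - q = p + (q :: 'k laurent2)"
  by (metis laurent_uminus diff_conv_add_uminus)

lemma laurent_add_eq_0_iff: "p + q = 0 \<longleftrightarrow> p = (q :: 'k laurent2)"
  by (metis laurent_diff right_minus_eq)

lemma partial_x_dbl [simp]: "partial_x (dbl p :: 'k laurent2) = 0"
  by (induction p rule: poly_mapping_induct_add)
     (simp_all add: dbl_add partial_x_add distrib_right)

lemma partial_y_dbl [simp]: "partial_y (dbl p :: 'k laurent2) = 0"
  by (induction p rule: poly_mapping_induct_add)
     (simp_all add: dbl_add partial_y_add distrib_right)

lemma partial_x_W: "partial_x W_pot = 1 + (mono_xy (-2) (-1) :: 'k laurent2)"
  by (simp add: W_pot_def partial_x_add mono_xy_def single_uminus laurent_uminus flip: single_one zero_prod_def)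

lemma partial_y_W: "partial_y W_pot = 1 + (mono_xy (-1) (-2) :: 'k laurent2)"
  by (simp add: W_pot_def partial_y_add mono_xy_def single_uminus laurent_uminus flip: single_one zero_prod_def)

abbreviation "wx \<equiv> partial_x W_pot :: 'k laurent2"
abbreviation "wy \<equiv> partial_y W_pot :: 'k laurent2"
abbreviation "wxy \<equiv> partial_x (partial_y W_pot) :: 'k laurent2"

lemma dbl_W: "dbl W_pot = W_pot * (W_pot :: 'k laurent2)"
  by (simp add: W_pot_def dbl_add mono_xy_mult distrib_left distrib_right ac_simps)

lemma dbl_partials_W: "dbl wx = wx * wx" "dbl wy = wy * wy"
  by (simp_all add: partial_x_W partial_y_W dbl_add mono_xy_mult distrib_left distrib_right ac_simps)

text \<open>
  Both partial derivatives of the potential have the form of the second factor, so neither is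
  a zero divisor.
\<close>
lemma mult_one_add_mono_eq_0:
  assumes "p * (1 + mono_xy i j) = (0 :: 'k laurent2)" "(i, j) \<noteq> (0, 0)"
  shows "p = 0"
proof (rule mono_xy_mult_fixed_imp_zero[OF _ assms(2)])
  show "mono_xy i j * p = p"
    using assms(1) by (simp add: distrib_left laurent_add_eq_0_iff mult.commute)
qed

lemma trivial_monomial_W:
  "(2, 1) \<in> trivial_monomials (ideal2 wx q)" "(1, 2) \<in> trivial_monomials (ideal2 q wy)"
proof -
  have "mono_xy 2 1 - 1 = mono_xy 2 1 * wx" "mono_xy 1 2 - 1 = mono_xy 1 2 * wy"
    by (simp_all add: laurent_diff partial_x_W partial_y_W distrib_left mono_xy_mult ac_simps)
  then show "(2, 1) \<in> trivial_monomials (ideal2 wx q)" "(1, 2) \<in> trivial_monomials (ideal2 q wy)"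
    by (simp_all add: trivial_monomials_def ideal2_mult generators_in_ideal2)
qed

text \<open>
  Regularity of the sequence \<open>(w\<^sub>x, w\<^sub>y)\<close>. The quotient by \<open>w\<^sub>x\<close> sets \<open>y = x\<^sup>-\<^sup>2\<close> and is the ring
  \<open>K[x\<^sup>\<plusminus>\<^sup>1]\<close>, realized here inside the same ring by pushing \<open>(i, j)\<close> to \<open>(i - 2j, 0)\<close>. There
  \<open>w\<^sub>y\<close> becomes \<open>1 + x\<^sup>3\<close>, which is not a zero divisor, so \<open>c\<close> vanishes in the quotient.
\<close>
lemma koszul_exact:
  assumes "b * wx + c * wy = 0"
  obtains t where "b = t * wy" "c = t * wx"
proof -
  define h :: "int \<times> int \<Rightarrow> int \<times> int" where "h = (\<lambda>(i, j). (i - 2 * j, 0))"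
  have h_add: "h (k + l) = h k + h l" for k l
    by (simp add: h_def split: prod.splits)
  have h01: "h 0 = 0" by (simp add: h_def zero_prod_def)
  have 1: "push h (1 :: 'k laurent2) = 1" by (simp add: h01 flip: single_one)
  have wx: "push h wx = 0"
    by (simp add: partial_x_W push_add 1) (simp add: h_def)
  have wy: "push h wy = 1 + mono_xy 3 0"
    by (simp add: partial_y_W push_add 1) (simp add: h_def)
  have "push h c * (1 + mono_xy 3 0) = push h (b * wx + c * wy)"
    by (simp add: push_add push_mult h_add wx wy)
  then have "push h c = 0"
    using mult_one_add_mono_eq_0[of "push h c" 3 0] by (simp add: assms)
  moreover have "c - push h c \<in> ideal2 wx 0"
  proof (rule diff_push_in_ideal2)
    fix k :: "int \<times> int"
    obtain i j where k: "k = (i, j)" by fastforce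
    show "k - h k \<in> trivial_monomials (ideal2 wx 0)"
      using trivial_monomials_scale[OF trivial_monomial_W(1), of j]
      by (simp add: k h_def mult.commute)
  qed
  ultimately obtain t where c: "c = t * wx" by (auto simp: ideal2_def)
  have "(b + t * wy) * wx = 0" using assms by (simp add: c algebra_simps)
  then have "b + t * wy = 0"
    unfolding partial_x_W by (rule mult_one_add_mono_eq_0) simp
  then show thesis using that c by (simp add: laurent_add_eq_0_iff)
qed

text \<open>
  The subgroup generated by the trivial exponents \<open>(2, 1)\<close> and \<open>(1, 2)\<close> contains
  \<open>3\<int>\<^sup>2\<close>, hence the difference between an exponent and its fourfold.
\<close>
lemma diff_dbl_dbl: "p - dbl (dbl p) \<in> ideal2 wx wy"
  unfolding dbl_def push_push
proof (rule diff_push_in_ideal2)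
  fix k :: "int \<times> int"
  obtain i j where k: "k = (i, j)" by fastforce
  let ?L = "trivial_monomials (ideal2 wx wy)"
  have "((-2 * i + j) * 2, (-2 * i + j) * 1) + ((i - 2 * j) * 1, (i - 2 * j) * 2) \<in> ?L"
    by (intro trivial_monomials_add trivial_monomials_scale trivial_monomial_W)
  then show "k - ((\<lambda>k. k + k) \<circ> (\<lambda>k. k + k)) k \<in> ?L"
    by (simp add: k algebra_simps)
qed

text \<open>
  Doubling maps the ideal into itself since it squares both generators. As its square is
  the identity modulo the ideal, it also reflects membership. This is what makes the
  comparison map from the Jacobian ring injective.
\<close>
lemma dbl_in_ideal_iff: "dbl p \<in> ideal2 wx wy \<longleftrightarrow> p \<in> ideal2 wx wy"
proof -
  have dbl: "dbl p \<in> ideal2 wx wy" if p: "p \<in> ideal2 wx wy" for p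
  proof -
    obtain r s where "p = r * wx + s * wy" using p by (auto simp: ideal2_def)
    then have "dbl p = (dbl r * wx) * wx + (dbl s * wy) * wy"
      by (simp add: dbl_add dbl_mult dbl_partials_W mult.assoc)
    then show ?thesis unfolding ideal2_def by blast
  qed
  have "p \<in> ideal2 wx wy" if "dbl p \<in> ideal2 wx wy"
    using ideal2_add[OF diff_dbl_dbl[of p] dbl[OF that]] by simp
  then show ?thesis using dbl by blast
qed

lemma dbl_linear_diff_op: "dbl_linear (diff_op a b c (e :: 'k laurent2))"
  by (simp add: dbl_linear_def diff_op_def partial_x_add partial_y_add partial_x_mult partial_y_mult
      algebra_simps)

text \<open>
  The coefficients can be solved for successively from the values at \<open>1\<close>, \<open>x\<close>, \<open>y\<close> and \<open>xy\<close>.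
\<close>
lemma dbl_linear_imp_diff_op:
  assumes "dbl_linear (g :: 'k laurent2 \<Rightarrow> 'k laurent2)"
  obtains a b c e where "g = diff_op a b c e"
proof -
  let ?u = "mono_xy 1 0 :: 'k laurent2" and ?v = "mono_xy 0 1 :: 'k laurent2"
  define a where "a = g 1"
  define b where "b = g ?u + a * ?u"
  define c where "c = g ?v + a * ?v"
  define e where "e = g (mono_xy 1 1) + a * mono_xy 1 1 + b * ?v + c * ?u"
  have g: "g 1 = a" "g ?u = a * ?u + b" "g ?v = a * ?v + c"
    "g (mono_xy 1 1) = a * mono_xy 1 1 + b * ?v + c * ?u + e"
    by (simp_all add: a_def b_def c_def e_def ac_simps)
  have d: "partial_x 1 = (0 :: 'k laurent2)" "partial_y 1 = (0 :: 'k laurent2)"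
    "partial_x ?u = 1" "partial_y ?u = 0" "partial_x ?v = 0" "partial_y ?v = 1"
    "partial_x (mono_xy 1 1) = ?v" "partial_y (mono_xy 1 1) = ?u" "partial_x 0 = (0 :: 'k laurent2)"
    by (simp_all add: mono_xy_def partial_x_def[of 0] flip: single_one zero_prod_def)
  have "g p = diff_op a b c e p" for p
    by (rule dbl_linear_eqI[OF assms dbl_linear_diff_op]) (auto simp: diff_op_def g d)
  then show thesis using that by blast
qed

text \<open>
  The Koszul differential in disguise: \<open>b\<close> and \<open>c\<close> are the terms of degree one, and the top term
  \<open>e\<close> is sent to \<open>(e w\<^sub>y, e w\<^sub>x)\<close>, with a correction \<open>e w\<^sub>x\<^sub>y\<close> in degree zero.
\<close>
lemma commutator_diff_op:
  "W_pot * diff_op a b c e p + diff_op a b c e (W_pot * p) =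
    diff_op (b * wx + c * wy + e * wxy) (e * wy) (e * wx) 0 p"
  by (simp add: diff_op_def partial_x_add partial_y_add partial_x_mult partial_y_mult algebra_simps)

lemma diff_op_eq_mult:
  assumes eq: "\<And>p. diff_op a b c 0 p = q * (p :: 'k laurent2)"
  shows "a = q" "b = 0" "c = 0"
proof -
  have d: "partial_x 1 = (0 :: 'k laurent2)" "partial_y 1 = (0 :: 'k laurent2)"
    "partial_x (mono_xy 1 0) = (1 :: 'k laurent2)" "partial_y (mono_xy 1 0) = (0 :: 'k laurent2)"
    "partial_x (mono_xy 0 1) = (0 :: 'k laurent2)" "partial_y (mono_xy 0 1) = (1 :: 'k laurent2)"
    by (simp_all add: mono_xy_def flip: single_one zero_prod_def)
  show "a = q" using eq[of 1] by (simp add: diff_op_def d)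
  then show "b = 0" "c = 0" using eq[of "mono_xy 1 0"] eq[of "mono_xy 0 1"] by (simp_all add: diff_op_def d)
qed

text \<open>
  Serves twice: \<open>q = 0\<close> describes the cocycles, general \<open>q\<close> the multiplications that are
  coboundaries.
\<close>
lemma commutator_eq_mult:
  assumes "\<And>p. W_pot * diff_op a b c e p + diff_op a b c e (W_pot * p) = q * (p :: 'k laurent2)"
  shows "e = 0" "q = b * wx + c * wy"
proof -
  have eq: "diff_op (b * wx + c * wy + e * wxy) (e * wy) (e * wx) 0 p = q * p" for p
    using assms by (simp add: commutator_diff_op)
  show "e = 0"
    using diff_op_eq_mult(3)[OF eq] unfolding partial_x_W by (rule mult_one_add_mono_eq_0) simp
  then show "q = b * wx + c * wy" using diff_op_eq_mult(1)[OF eq] by simp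
qed

text \<open>
  Cocycles are scalar up to coboundaries. A coboundary of \<open>t \<partial>\<^sub>x\<partial>\<^sub>y\<close> removes the first order part and
  leaves a multiplication by some \<open>a'\<close>; modulo the ideal \<open>a'\<close> is in the image of \<open>dbl\<close>,
  and elements of the ideal are coboundaries of first order operators.
\<close>
lemma commuting_operator:
  assumes g: "dbl_linear g" and comm: "\<And>p. W_pot * g p + g (W_pot * p) = (0 :: 'k laurent2)"
  obtains \<alpha> h where "dbl_linear h" "\<And>p. g p = dbl \<alpha> * p + (W_pot * h p + h (W_pot * p))"
proof -
  obtain a b c e where g_eq: "g = diff_op a b c e"
    using dbl_linear_imp_diff_op[OF g] .
  have "e = 0" and "0 = b * wx + c * wy"
    using commutator_eq_mult[of a b c e 0] comm by (simp_all add: g_eq)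
  then obtain t where bc: "b = t * wy" "c = t * wx" using koszul_exact by metis
  \<comment> \<open>The summand \<open>t * wxy\<close> compensates the zeroth order term in the commutator with \<open>t \<partial>\<^sub>x\<partial>\<^sub>y\<close>.\<close>
  define a' where "a' = a + t * wxy"
  obtain r s where "a' - dbl (dbl a') = r * wx + s * wy"
    using diff_dbl_dbl[of a'] by (auto simp: ideal2_def)
  then have "a' = dbl (dbl a') + (r * wx + s * wy)" by (simp add: diff_eq_eq add.commute)
  moreover have "a = a' + t * wxy" by (simp add: a'_def add.assoc)
  ultimately have a: "a = dbl (dbl a') + (r * wx + s * wy + t * wxy)" by (metis add.assoc)
  have "g p = dbl (dbl a') * p + (W_pot * diff_op 0 r s t p + diff_op 0 r s t (W_pot * p))" for p
    unfolding commutator_diff_op g_eq by (simp add: diff_op_def a bc \<open>e = 0\<close> algebra_simps)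
  then show thesis using that dbl_linear_diff_op by blast
qed

text \<open>
  The kernel of the map from \<open>A\<close> to the homotopy classes of endomorphisms.
\<close>
lemma mult_is_commutator_iff:
  "(\<exists>h. dbl_linear h \<and> (\<forall>p. dbl \<alpha> * p = W_pot * h p + h (W_pot * p))) \<longleftrightarrow> \<alpha> \<in> ideal2 wx wy"
proof
  assume "\<exists>h. dbl_linear h \<and> (\<forall>p. dbl \<alpha> * p = W_pot * h p + h (W_pot * p))"
  then obtain h where h: "dbl_linear h" "\<And>p. W_pot * h p + h (W_pot * p) = dbl \<alpha> * p" by auto
  obtain a b c e where h_eq: "h = diff_op a b c e"
    using dbl_linear_imp_diff_op[OF h(1)] .
  have "dbl \<alpha> = b * wx + c * wy"
    using commutator_eq_mult(2)[of a b c e] h(2) by (simp add: h_eq)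
  then have "dbl \<alpha> \<in> ideal2 wx wy" by (auto simp: ideal2_def)
  then show "\<alpha> \<in> ideal2 wx wy" by (simp only: dbl_in_ideal_iff)
next
  assume "\<alpha> \<in> ideal2 wx wy"
  then have "dbl \<alpha> \<in> ideal2 wx wy" by (simp only: dbl_in_ideal_iff)
  then obtain r s where "dbl \<alpha> = r * wx + s * wy" by (auto simp: ideal2_def)
  then have "dbl \<alpha> * p = W_pot * diff_op 0 r s 0 p + diff_op 0 r s 0 (W_pot * p)" for p
    unfolding commutator_diff_op by (simp add: diff_op_def)
  then show "\<exists>h. dbl_linear h \<and> (\<forall>p. dbl \<alpha> * p = W_pot * h p + h (W_pot * p))"
    using dbl_linear_diff_op by blast
qed

end

section \<open>Endomorphism rings of ungraded matrix factorizations\<close>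

context
  fixes s :: "'a::comm_ring_1 \<Rightarrow> 'e::ab_group_add \<Rightarrow> 'e" and Q :: "'e \<Rightarrow> 'e" and W :: 'a
  assumes mf: "ungraded_mf W (s, Q)" and two: "\<And>v::'e. v + v = 0"
begin

lemma mf_module: "Modules.module s"
  using mf by (simp add: ungraded_mf_def fin_free_module_def)

lemma mf_hom_iff: "f \<in> mf_hom (s, Q) (s, Q) \<longleftrightarrow>
    (\<forall>v w. f (v + w) = f v + f w) \<and> (\<forall>r v. f (s r v) = s r (f v))"
  by (auto simp: mf_hom_def module_hom_iff mf_module)

lemma mf_Q: "Q (v + w) = Q v + Q w" "Q (s r v) = s r (Q v)" "Q (Q v) = s W v"
  using mf by (auto simp: ungraded_mf_def module_hom_iff)

lemma mf_add_eq_0_iff: "v + w = 0 \<longleftrightarrow> v = (w :: 'e)"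
  by (metis add_right_cancel two)

lemma mf_ker_iff: "f \<in> mf_ker (s, Q) (s, Q) \<longleftrightarrow>
    f \<in> mf_hom (s, Q) (s, Q) \<and> (\<forall>v. Q (f v) = f (Q v))"
  by (auto simp: mf_ker_def mf_diff_def fun_eq_iff mf_add_eq_0_iff)

lemma mf_s: "s r (v + w) = s r v + s r w" "s r 0 = 0" "s r (s r' v) = s (r * r') v"
    "s (r + r') v = s r v + s r' v" "s 1 v = v"
  using mf_module
  by (simp_all add: module.scale_right_distrib module.scale_left_distrib module.scale_scale
      module.scale_zero_right module.scale_one)

lemma mf_ker_ring: "ring (mf_ker_ring (s, Q))"
proof (rule ringI)
  show "abelian_group (mf_ker_ring (s, Q))"
  proof (rule abelian_groupI)
    fix f assume "f \<in> carrier (mf_ker_ring (s, Q))"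
    then show "\<exists>g\<in>carrier (mf_ker_ring (s, Q)). g \<oplus>\<^bsub>mf_ker_ring (s, Q)\<^esub> f = \<zero>\<^bsub>mf_ker_ring (s, Q)\<^esub>"
      by (intro bexI[of _ f]) (simp_all add: mf_ker_ring_def two)
  qed (auto simp: mf_ker_ring_def mf_ker_iff mf_hom_iff mf_Q mf_s ac_simps mf_Q(1)[of 0 0, simplified])
  show "Group.monoid (mf_ker_ring (s, Q))"
    by (rule monoidI) (auto simp: mf_ker_ring_def mf_ker_iff mf_hom_iff)
qed (auto simp: mf_ker_ring_def mf_ker_iff mf_hom_iff)

text \<open>
  Coboundaries are closed under composition with cocycles because \<open>f \<circ> d h = d (f \<circ> h)\<close> and
  \<open>d h \<circ> f = d (h \<circ> f)\<close> for a cocycle \<open>f\<close>, which commutes with \<open>Q\<close>.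
\<close>
lemma mf_im_ideal: "ideal (mf_im (s, Q) (s, Q)) (mf_ker_ring (s, Q))"
proof (rule idealI[OF mf_ker_ring])
  let ?H = "mf_hom (s, Q) (s, Q)" and ?d = "mf_diff (s, Q) (s, Q)"
  have ker: "?d h \<in> mf_ker (s, Q) (s, Q)" if "h \<in> ?H" for h
    using that by (auto simp: mf_ker_iff mf_hom_iff mf_diff_def mf_Q mf_s ac_simps)
  have inv: "inv\<^bsub>add_monoid (mf_ker_ring (s, Q))\<^esub> f = f" if "f \<in> mf_ker (s, Q) (s, Q)" for f
    using that ring.is_abelian_group[OF mf_ker_ring]
    by (intro group.inv_equality[OF abelian_group.a_group]) (auto simp: mf_ker_ring_def two)
  show "subgroup (mf_im (s, Q) (s, Q)) (add_monoid (mf_ker_ring (s, Q)))"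
  proof
    show "mf_im (s, Q) (s, Q) \<subseteq> carrier (add_monoid (mf_ker_ring (s, Q)))"
      using ker by (auto simp: mf_ker_ring_def mf_im_def)
    have "?d (\<lambda>v. 0) = (\<lambda>v. 0)" "(\<lambda>v. 0) \<in> ?H"
      using mf_Q(1)[of 0 0] by (auto simp: mf_diff_def mf_hom_iff mf_s)
    then show "\<one>\<^bsub>add_monoid (mf_ker_ring (s, Q))\<^esub> \<in> mf_im (s, Q) (s, Q)"
      by (auto simp: mf_ker_ring_def mf_im_def intro: rev_image_eqI)
  next
    fix f g assume "f \<in> mf_im (s, Q) (s, Q)" "g \<in> mf_im (s, Q) (s, Q)"
    then obtain h k where hk: "h \<in> ?H" "f = ?d h" "k \<in> ?H" "g = ?d k" by (auto simp: mf_im_def)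
    then have "(\<lambda>v. f v + g v) = ?d (\<lambda>v. h v + k v)" "(\<lambda>v. h v + k v) \<in> ?H"
      by (auto simp: mf_diff_def mf_hom_iff mf_Q mf_s ac_simps)
    then show "f \<otimes>\<^bsub>add_monoid (mf_ker_ring (s, Q))\<^esub> g \<in> mf_im (s, Q) (s, Q)"
      by (auto simp: mf_ker_ring_def mf_im_def)
  next
    fix f assume f: "f \<in> mf_im (s, Q) (s, Q)"
    then have "f \<in> mf_ker (s, Q) (s, Q)" using ker by (auto simp: mf_im_def)
    then show "inv\<^bsub>add_monoid (mf_ker_ring (s, Q))\<^esub> f \<in> mf_im (s, Q) (s, Q)"
      using f inv by metis
  qed
  fix f g assume "f \<in> mf_im (s, Q) (s, Q)" "g \<in> carrier (mf_ker_ring (s, Q))"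
  then obtain h where h: "h \<in> ?H" "f = ?d h" and g: "g \<in> ?H" "\<And>v. Q (g v) = g (Q v)"
    by (auto simp: mf_im_def mf_ker_ring_def mf_ker_iff)
  then have "g \<circ> f = ?d (g \<circ> h)" "g \<circ> h \<in> ?H" "f \<circ> g = ?d (h \<circ> g)" "h \<circ> g \<in> ?H"
    by (auto simp: mf_diff_def mf_hom_iff)
  then show "g \<otimes>\<^bsub>mf_ker_ring (s, Q)\<^esub> f \<in> mf_im (s, Q) (s, Q)"
    "f \<otimes>\<^bsub>mf_ker_ring (s, Q)\<^esub> g \<in> mf_im (s, Q) (s, Q)"
    by (auto simp: mf_ker_ring_def mf_im_def)
qed

lemma scalars_ring_hom: "s \<in> ring_hom ring_of_type_algebra (mf_ker_ring (s, Q))"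
  by (rule ring_hom_memI)
     (auto simp: ring_of_type_algebra_def mf_ker_ring_def mf_ker_iff mf_hom_iff mf_s mf_Q mult.commute)

text \<open>
  The homomorphism theorem for \<open>\<alpha> \<mapsto> [\<alpha> \<cdot> Id]\<close>: only its kernel and its surjectivity have to be
  determined for a particular factorization.
\<close>
lemma scalars_induce_iso:
  assumes J: "\<And>\<alpha>. s \<alpha> \<in> mf_im (s, Q) (s, Q) \<longleftrightarrow> \<alpha> \<in> J"
    and surj: "\<And>f. f \<in> mf_ker (s, Q) (s, Q) \<Longrightarrow>
      \<exists>\<alpha>. \<exists>h\<in>mf_hom (s, Q) (s, Q). f = (\<lambda>v. s \<alpha> v + mf_diff (s, Q) (s, Q) h v)"
  shows "\<exists>C \<in> ring_iso (ring_of_type_algebra Quot J) (mf_end_H (s, Q)).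
    \<forall>\<alpha>. C (J +>\<^bsub>ring_of_type_algebra\<^esub> \<alpha>) = mf_class (s, Q) (s \<alpha>)"
proof -
  let ?I = "mf_im (s, Q) (s, Q)" and ?S = "mf_ker_ring (s, Q)"
  let ?R = "ring_of_type_algebra :: 'a ring"
  interpret ideal ?I ?S by (rule mf_im_ideal)
  define c where "c \<alpha> = mf_class (s, Q) (s \<alpha>)" for \<alpha>
  have c: "c = (+>\<^bsub>?S\<^esub>) ?I \<circ> s" by (simp add: c_def fun_eq_iff mf_class_def)
  have s_ker: "s \<alpha> \<in> carrier ?S" for \<alpha>
    using ring_hom_closed[OF scalars_ring_hom] by (simp add: ring_of_type_algebra_def)
  have "c \<in> ring_hom ?R (mf_end_H (s, Q))"
    unfolding c mf_end_H_def by (rule ring_hom_trans[OF scalars_ring_hom rcos_ring_hom])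
  then interpret c: ring_hom_ring ?R "mf_end_H (s, Q)" c
    by (intro ring_hom_ringI2) (simp_all add: mf_end_H_def quotient_is_ring ring_from_type_algebra)
  have kernel: "a_kernel ?R (mf_end_H (s, Q)) c = J"
  proof -
    have "c \<alpha> = \<zero>\<^bsub>mf_end_H (s, Q)\<^esub> \<longleftrightarrow> \<alpha> \<in> J" for \<alpha>
    proof -
      have "?I +>\<^bsub>?S\<^esub> s \<alpha> = ?I \<longleftrightarrow> s \<alpha> \<in> ?I"
        using rcos_const_imp_mem[OF s_ker] a_rcos_zero[OF ideal_axioms] by blast
      then show ?thesis unfolding c_def mf_class_def mf_end_H_def FactRing_def by (simp only: J ring.simps)
    qed
    moreover have "carrier ?R = UNIV" by (simp add: ring_of_type_algebra_def)
    ultimately show ?thesis unfolding a_kernel_def' by blast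
  qed
  have onto: "c ` carrier ?R = carrier (mf_end_H (s, Q))"
  proof -
    have "Y \<in> range c" if Y: "Y \<in> carrier (mf_end_H (s, Q))" for Y
    proof -
      from Y obtain f where f: "f \<in> carrier ?S" "Y = ?I +>\<^bsub>?S\<^esub> f"
        by (auto simp: mf_end_H_def FactRing_def A_RCOSETS_def')
      then obtain \<alpha> h where h: "h \<in> mf_hom (s, Q) (s, Q)"
        "f = (\<lambda>v. s \<alpha> v + mf_diff (s, Q) (s, Q) h v)"
        using surj[of f] by (auto simp: mf_ker_ring_def)
      then have "f = mf_diff (s, Q) (s, Q) h \<oplus>\<^bsub>?S\<^esub> s \<alpha>"
        by (simp add: mf_ker_ring_def add.commute)
      then have "f \<in> ?I +>\<^bsub>?S\<^esub> s \<alpha>"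
        using h by (auto simp: a_r_coset_def' mf_im_def)
      then have "Y = c \<alpha>"
        unfolding c_def mf_class_def f(2)
        by (rule a_repr_independence[OF _ s_ker a_subgroup, symmetric])
      then show ?thesis by blast
    qed
    moreover have "carrier ?R = UNIV" by (simp add: ring_of_type_algebra_def)
    ultimately show ?thesis using c.hom_closed by (metis subsetI subset_antisym image_subsetI)
  qed
  let ?C = "\<lambda>Y. the_elem (c ` Y)"
  have "?C \<in> ring_iso (?R Quot J) (mf_end_H (s, Q))"
    using c.FactRing_iso_set[OF onto] unfolding kernel .
  moreover have "?C (J +>\<^bsub>?R\<^esub> \<alpha>) = mf_class (s, Q) (s \<alpha>)" for \<alpha>
    using c.the_elem_simp[of \<alpha>] unfolding kernel c_def by (simp add: ring_of_type_algebra_def)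
  ultimately show ?thesis by (intro bexI[of _ ?C]) simp_all
qed

end

section \<open>The matrix factorization as the double cover\<close>

lemma vector_4 [simp]:
  "(vector [p, q, r, s] :: 'a::zero ^ 4) $ 1 = p"
  "(vector [p, q, r, s] :: 'a::zero ^ 4) $ 2 = q"
  "(vector [p, q, r, s] :: 'a::zero ^ 4) $ 3 = r"
  "(vector [p, q, r, s] :: 'a::zero ^ 4) $ 4 = s"
  unfolding vector_def by simp_all

lemma module_vector_smult: "Modules.module ((*s) :: 'a::comm_ring_1 \<Rightarrow> 'a ^ 'n \<Rightarrow> 'a ^ 'n)"
  by unfold_locales (simp_all add: vector_add_ldistrib vector_sadd_rdistrib)

lemma fin_free_module_vector:
  "fin_free_module ((*s) :: 'a::comm_ring_1 \<Rightarrow> 'a ^ 'n \<Rightarrow> 'a ^ 'n::finite)"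
proof -
  interpret Modules.module "(*s) :: 'a \<Rightarrow> 'a ^ 'n \<Rightarrow> 'a ^ 'n" by (rule module_vector_smult)
  let ?e = "\<lambda>i. axis i 1 :: 'a ^ 'n"
  have inj: "inj ?e" by (auto simp: inj_def axis_eq_axis)
  have sum: "(\<Sum>v\<in>range ?e. u v *s v) = (\<chi> i. u (?e i))" for u :: "'a ^ 'n \<Rightarrow> 'a"
  proof -
    have "(\<Sum>v\<in>range ?e. u v *s v) = (\<Sum>i\<in>UNIV. u (?e i) *s ?e i)"
      by (rule sum.reindex_cong[OF inj]) simp_all
    also have "\<dots> = (\<chi> i. u (?e i))"
      by (simp add: vec_eq_iff axis_def if_distrib cong: if_cong)
    finally show ?thesis .
  qed
  have "independent (range ?e)"
    by (auto simp: dependent_finite sum vec_eq_iff)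
  moreover have "v \<in> span (range ?e)" for v
  proof -
    have "v = (\<Sum>b\<in>range ?e. v $ (inv_into UNIV ?e b) *s b)"
      by (simp add: sum inv_f_f[OF inj] vec_eq_iff)
    then show ?thesis unfolding span_finite[OF finite_imageI[OF finite]]
      by (rule range_eqI[where x = "\<lambda>b. v $ inv_into UNIV ?e b"])
  qed
  then have "span (range ?e) = UNIV" by blast
  ultimately show ?thesis
    unfolding fin_free_module_def
    by (intro conjI exI[of _ "range ?e"]) (rule module_axioms, simp_all)
qed

text \<open>
  An \<open>A\<close>-linear retraction of \<open>dbl\<close>: it keeps the monomials with even exponents. Shifted by
  monomials, it gives the coordinates of the double cover as a free module of rank four.
\<close>
definition half :: "'k::comm_ring_1 laurent2 \<Rightarrow> 'k laurent2"
  where "half = Poly_Mapping.map_key (\<lambda>k. k + k)"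

lemma inj_double: "inj (\<lambda>k::int \<times> int. k + k)"
  by (auto simp: inj_def)

lemma lookup_half: "Poly_Mapping.lookup (half p) k = Poly_Mapping.lookup p (k + k)"
  by (simp add: half_def map_key.rep_eq[OF inj_double])

lemma half_add: "half (p + q) = half p + half q"
  by (simp add: half_def map_key_plus[OF inj_double])

lemma half_dbl_mult: "half (dbl a * p) = a * half p"
proof (induction a rule: poly_mapping_induct_add)
  case (single k c)
  have "l + l - (k + k) = (l - k) + (l - k)" for l :: "int \<times> int" by (simp add: algebra_simps)
  then show ?case
    by (intro poly_mapping_eqI) (simp only: dbl_single lookup_half lookup_single_mult)
qed (simp add: dbl_add half_add distrib_right)

lemma half_mono_xy:
  "half (mono_xy i j) = (if even i \<and> even j then mono_xy (i div 2) (j div 2) else 0)"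
  by (rule poly_mapping_eqI) (auto simp: lookup_half mono_xy_def lookup_single when_def, presburger+)

lemma half_1 [simp]: "half 1 = 1"
  using half_mono_xy[of 0 0] by simp

definition to_cover :: "'k::comm_ring_1 laurent2 ^ 4 \<Rightarrow> 'k laurent2"
  where "to_cover v = dbl (v $ 1) + dbl (v $ 2) * mono_xy 0 (-1) +
    dbl (v $ 3) * mono_xy (-1) 0 + dbl (v $ 4) * mono_xy (-1) (-1)"

definition of_cover :: "'k::comm_ring_1 laurent2 \<Rightarrow> 'k laurent2 ^ 4"
  where "of_cover p =
    vector [half p, half (mono_xy 0 1 * p), half (mono_xy 1 0 * p), half (mono_xy 1 1 * p)]"

lemma to_cover_add: "to_cover (v + w) = to_cover v + to_cover w"
  by (simp add: to_cover_def dbl_add algebra_simps)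

lemma to_cover_smult: "to_cover (a *s v) = dbl a * to_cover v"
  by (simp add: to_cover_def dbl_mult algebra_simps)

lemma of_cover_add: "of_cover (p + q) = of_cover p + of_cover q"
  by (simp add: of_cover_def vec_eq_iff forall_4 half_add distrib_left)

lemma of_cover_smult: "of_cover (dbl a * p) = a *s of_cover p"
  by (simp add: of_cover_def vec_eq_iff forall_4 half_dbl_mult mult.left_commute[of _ "dbl a"])

lemma of_cover_to_cover [simp]: "of_cover (to_cover v) = v"
proof -
  have "half (p * (dbl a * q)) = a * half (p * q)" "half (p * dbl a) = a * half p"
    for a p q :: "'a laurent2"
    by (metis half_dbl_mult mult.left_commute) (metis half_dbl_mult mult.commute)
  moreover have "half (dbl a) = a" for a :: "'a laurent2"
    using half_dbl_mult[of a 1] by simp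
  ultimately show ?thesis
    by (simp add: of_cover_def to_cover_def vec_eq_iff forall_4 distrib_left half_add half_dbl_mult
        half_mono_xy mono_xy_mult)
qed

lemma to_cover_inject [simp]: "to_cover v = to_cover w \<longleftrightarrow> v = w"
  by (rule inj_eq) (rule inj_on_inverseI, rule of_cover_to_cover)

lemma to_cover_of_cover [simp]: "to_cover (of_cover p) = p"
proof (rule dbl_linear_eqI[where g = "\<lambda>p. to_cover (of_cover p)" and h = "\<lambda>p. p"])
  show "to_cover (of_cover (mono_xy i j)) = mono_xy i j" if "i \<in> {0, 1}" "j \<in> {0, 1}" for i j
    using that
    by (auto simp: of_cover_def to_cover_def half_mono_xy mono_xy_mult)
qed (simp_all add: dbl_linear_def of_cover_add of_cover_smult to_cover_add to_cover_smult)

context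
  assumes char2: "CHAR('k::field) = 2"
begin

text \<open>
  In this basis the matrix is multiplication by \<open>u + v + u\<^sup>-\<^sup>1v\<^sup>-\<^sup>1\<close>.
\<close>
lemma to_cover_Q: "to_cover (Q_RP2_matrix *v v) = W_pot * (to_cover v :: 'k laurent2)"
proof -
  have Q: "(Q_RP2_matrix *v v) $ 1 = v $ 2 + v $ 3 + mono_xy (-1) (-1) * v $ 4"
    "(Q_RP2_matrix *v v) $ 2 = mono_xy 0 1 * v $ 1 + mono_xy (-1) 0 * v $ 3 + v $ 4"
    "(Q_RP2_matrix *v v) $ 3 = mono_xy 1 0 * v $ 1 + mono_xy 0 (-1) * v $ 2 + v $ 4"
    "(Q_RP2_matrix *v v) $ 4 = v $ 1 + mono_xy 1 0 * v $ 2 + mono_xy 0 1 * v $ 3"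
    by (simp_all add: matrix_vector_mult_def sum_4 Q_RP2_matrix_def)
  \<comment> \<open>The doubled coordinates \<open>dbl (v $ i)\<close> are replaced by variables, so that normalization moves all monomials next to each other.\<close>
  have "(b + c + mono_xy (-2) (-2) * d) +
      (mono_xy 0 2 * a + mono_xy (-2) 0 * c + d) * mono_xy 0 (-1) +
      (mono_xy 2 0 * a + mono_xy 0 (-2) * b + d) * mono_xy (-1) 0 +
      (a + mono_xy 2 0 * b + mono_xy 0 2 * c) * mono_xy (-1) (-1) =
    W_pot * (a + b * mono_xy 0 (-1) + c * mono_xy (-1) 0 + d * mono_xy (-1) (-1))"
    for a b c d :: "'k laurent2"
    by (simp add: W_pot_def algebra_simps mono_xy_mult)
  then show ?thesis
    by (simp add: to_cover_def Q dbl_add dbl_mult)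
qed

lemma vector_double_eq_0: "(v :: 'k laurent2 ^ 4) + v = 0"
  by (simp add: vec_eq_iff laurent_two_eq_0[OF char2])

lemma of_cover_W: "of_cover (W_pot * p) = Q_RP2_matrix *v (of_cover p :: 'k laurent2 ^ 4)"
  by (simp add: to_cover_Q flip: to_cover_inject)

lemma ungraded_mf_Q_RP2: "ungraded_mf W_pot ((*s), (*v) (Q_RP2_matrix :: 'k laurent2 ^ 4 ^ 4))"
proof -
  have "Q_RP2_matrix *v (Q_RP2_matrix *v v) = W_pot *s v" for v :: "'k laurent2 ^ 4"
  proof -
    have "to_cover (Q_RP2_matrix *v (Q_RP2_matrix *v v)) = to_cover (W_pot *s v)"
      by (simp add: to_cover_Q to_cover_smult dbl_W[OF char2] mult.assoc)
    then show ?thesis by simp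
  qed
  moreover have "A *v (c *s v) = c *s (A *v v)" for A :: "'k laurent2 ^ 4 ^ 4" and c v
    by (simp add: matrix_vector_mult_def vec_eq_iff sum_distrib_left mult.left_commute)
  ultimately show ?thesis
    by (simp add: ungraded_mf_def fin_free_module_vector module_hom_iff module_vector_smult
        matrix_vector_right_distrib)
qed

text \<open>
  Both coordinate maps are linear along \<open>dbl\<close>, so conjugation with them identifies the
  endomorphisms of \<open>A\<^sup>4\<close> with those of the double cover.
\<close>
lemma hom_iff_dbl_linear:
  "f \<in> mf_hom ((*s), (*v) Q_RP2_matrix) ((*s), (*v) Q_RP2_matrix) \<longleftrightarrow>
    dbl_linear (\<lambda>p. to_cover (f (of_cover p)) :: 'k laurent2)"
proof
  assume "dbl_linear (\<lambda>p. to_cover (f (of_cover p)) :: 'k laurent2)"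
  then have g: "to_cover (f (of_cover (p + q))) = to_cover (f (of_cover p)) + to_cover (f (of_cover q))"
    "to_cover (f (of_cover (dbl a * p))) = dbl a * to_cover (f (of_cover p))" for a p q
    by (auto simp: dbl_linear_def)
  have "f (v + w) = f v + f w" for v w
    using g(1)[of "to_cover v" "to_cover w"]
    by (simp add: of_cover_add flip: to_cover_add)
  moreover have "f (a *s v) = a *s f v" for a v
    using g(2)[of a "to_cover v"]
    by (simp add: of_cover_smult flip: to_cover_smult)
  ultimately show "f \<in> mf_hom ((*s), (*v) Q_RP2_matrix) ((*s), (*v) Q_RP2_matrix)"
    by (simp add: mf_hom_iff[OF ungraded_mf_Q_RP2 vector_double_eq_0])
qed (simp add: mf_hom_iff[OF ungraded_mf_Q_RP2 vector_double_eq_0] dbl_linear_def of_cover_add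
    of_cover_smult to_cover_add to_cover_smult)

end

theorem theorem1p5:
  assumes "CHAR('k::field) = 2"
  shows "ungraded_mf W_pot (Q_RP2 :: ('k laurent2, 'k laurent2 ^ 4) mf_pair) \<and>
    (\<exists>C \<in> ring_iso (Jac (W_pot :: 'k laurent2)) (mf_end_H Q_RP2).
      \<forall>\<alpha> :: 'k laurent2. C (jac_class W_pot \<alpha>) = mf_class Q_RP2 (\<lambda>v. \<alpha> *s v))"
proof -
  let ?E = "((*s), (*v) Q_RP2_matrix) :: ('k laurent2, 'k laurent2 ^ 4) mf_pair"
  let ?J = "jac_ideal W_pot :: 'k laurent2 set"
  note mf = ungraded_mf_Q_RP2[OF assms] and two = vector_double_eq_0[OF assms]
    and hom = hom_iff_dbl_linear[OF assms]
  \<comment> \<open>Under the transport the differential is the commutator with \<open>W_pot\<close>; signs do not matter in characteristic two.\<close>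
  have d: "to_cover (mf_diff ?E ?E f v) =
      W_pot * to_cover (f v) + to_cover (f (of_cover (W_pot * to_cover v)))" for f v
    by (simp add: mf_diff_def to_cover_add to_cover_Q[OF assms] of_cover_W[OF assms])
  have "\<exists>C \<in> ring_iso (ring_of_type_algebra Quot ?J) (mf_end_H ?E).
      \<forall>\<alpha>. C (?J +>\<^bsub>ring_of_type_algebra\<^esub> \<alpha>) = mf_class ?E ((*s) \<alpha>)"
  proof (rule scalars_induce_iso[OF mf two])
    fix \<alpha> :: "'k laurent2"
    have "(*s) \<alpha> \<in> mf_im ?E ?E \<longleftrightarrow>
        (\<exists>h. dbl_linear h \<and> (\<forall>p. dbl \<alpha> * p = W_pot * h p + h (W_pot * p)))"
    proof
      assume "(*s) \<alpha> \<in> mf_im ?E ?E"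
      then obtain f where f: "f \<in> mf_hom ?E ?E" "(*s) \<alpha> = mf_diff ?E ?E f"
        by (auto simp: mf_im_def)
      let ?h = "\<lambda>p. to_cover (f (of_cover p))"
      have "dbl \<alpha> * p = W_pot * ?h p + ?h (W_pot * p)" for p
        using d[of f "of_cover p"] to_cover_smult[of \<alpha> "of_cover p"] by (simp flip: f(2))
      then show "\<exists>h. dbl_linear h \<and> (\<forall>p. dbl \<alpha> * p = W_pot * h p + h (W_pot * p))"
        using f(1) hom by blast
    next
      assume "\<exists>h. dbl_linear h \<and> (\<forall>p. dbl \<alpha> * p = W_pot * h p + h (W_pot * p))"
      then obtain h where h: "dbl_linear h" "\<And>p. dbl \<alpha> * p = W_pot * h p + h (W_pot * p)" by blast
      let ?f = "\<lambda>v. of_cover (h (to_cover v))"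
      have "to_cover (\<alpha> *s v) = to_cover (mf_diff ?E ?E ?f v)" for v
        by (simp add: d to_cover_smult h(2))
      then have "(*s) \<alpha> = mf_diff ?E ?E ?f" by (simp add: fun_eq_iff)
      moreover have "?f \<in> mf_hom ?E ?E" by (simp add: hom h(1))
      ultimately show "(*s) \<alpha> \<in> mf_im ?E ?E" unfolding mf_im_def by blast
    qed
    then show "(*s) \<alpha> \<in> mf_im ?E ?E \<longleftrightarrow> \<alpha> \<in> ?J"
      by (simp add: mult_is_commutator_iff[OF assms] jac_ideal_def genideal_pair)
  next
    fix f assume f: "f \<in> mf_ker ?E ?E"
    let ?g = "\<lambda>p. to_cover (f (of_cover p))"
    have "dbl_linear ?g" using f by (simp add: mf_ker_def hom)
    moreover have "W_pot * ?g p + ?g (W_pot * p) = 0" for p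
      using f d[of f "of_cover p"] by (simp add: mf_ker_def) (simp add: to_cover_def)
    ultimately obtain \<alpha> h where h: "dbl_linear h"
      "\<And>p. ?g p = dbl \<alpha> * p + (W_pot * h p + h (W_pot * p))"
      using commuting_operator[OF assms, of ?g] by metis
    let ?f = "\<lambda>v. of_cover (h (to_cover v))"
    have "to_cover (f v) = to_cover (\<alpha> *s v + mf_diff ?E ?E ?f v)" for v
      using h(2)[of "to_cover v"] by (simp add: d to_cover_add to_cover_smult)
    then have "f = (\<lambda>v. \<alpha> *s v + mf_diff ?E ?E ?f v)" by (simp add: fun_eq_iff)
    moreover have "?f \<in> mf_hom ?E ?E" by (simp add: hom h(1))
    ultimately show "\<exists>\<alpha>. \<exists>h\<in>mf_hom ?E ?E. f = (\<lambda>v. \<alpha> *s v + mf_diff ?E ?E h v)" by blast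
  qed
  then show ?thesis
    using mf by (simp add: Q_RP2_def Jac_def jac_class_def)
qed

end
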